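(* Let $\mathfrak{a}_{1},\mathfrak{a}_2,\ldots\in GL_l(\mathbb{C})$. For all $m\geq 1$, $$\det \mathfrak{Q}_{m}=\det \mathfrak{p}_{m}(\mathfrak{a}_{1},\ldots,\mathfrak{a}_{m}).$$
   Context: $I$, $O$ are the $l\times l$ identity and zero matrices. The left matrix signed Chebyshev polynomials are defined by $\mathfrak{p}_{-1}=O$, $\mathfrak{p}_{0}=I$ and $$\mathfrak{p}_{m}(\mathfrak{a}_{1},\ldots,\mathfrak{a}_{m})=\mathfrak{a}_{m}\mathfrak{p}_{m-1}(\mathfrak{a}_{1},\ldots,\mathfrak{a}_{m-1})-\mathfrak{p}_{m-2}(\mathfrak{a}_{1},\ldots,\mathfrak{a}_{m-2}),\quad m\ge 1.$$ $\mathfrak{Q}_1=\mathfrak{a}_1$ and, for $m\ge 2$, $\mathfrak{Q}_m$ is the block tridiagonal $ml\times ml$ matrix with diagonal blocks $\mathfrak{a}_{m},\mathfrak{a}_{m-1},\ldots,\mathfrak{a}_1$ (from top left to bottom right), all blocks immediately above and immediately below the diagonal equal to $I$, and all other blocks equal to $O$: $$\mathfrak{Q}_{m}=\begin{pmatrix} \mathfrak{a}_{m} & I & O & \cdots & O\\ I & \mathfrak{a}_{m-1} & \ddots & \ddots & \vdots\\ O & \ddots & \ddots & \ddots & O\\ \vdots & \ddots & \ddots & \ddots & I\\ O & \cdots & O & I & \mathfrak{a}_{1}\end{pmatrix}.$$ *)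

theory Defs
  imports "Jordan_Normal_Form.Determinant"
begin

(* The sequence a_1, a_2, ... is a function on nat whose value at 0 is never used.
   The index -1 is eliminated: the second equation is the recurrence at m = 1
   with p_0 = I and p_{-1} = O substituted. *)
fun left_cheb :: "nat \<Rightarrow> (nat \<Rightarrow> complex mat) \<Rightarrow> nat \<Rightarrow> complex mat" where
  "left_cheb l a 0 = 1\<^sub>m l"
| "left_cheb l a (Suc 0) = a 1 * 1\<^sub>m l - 0\<^sub>m l l"
| "left_cheb l a (Suc (Suc m)) = a (Suc (Suc m)) * left_cheb l a (Suc m) - left_cheb l a m"

(* Block rows r and block columns c are counted from 0, so the diagonal blocks
   for r = 0, ..., m - 1 are a_m, ..., a_1. *)
definition Q_block :: "nat \<Rightarrow> (nat \<Rightarrow> complex mat) \<Rightarrow> nat \<Rightarrow> nat \<Rightarrow> nat \<Rightarrow> complex mat" where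
  "Q_block l a m r c =
     (if r = c then a (m - r)
      else if c = Suc r \<or> r = Suc c then 1\<^sub>m l
      else 0\<^sub>m l l)"

definition Q_mat :: "nat \<Rightarrow> (nat \<Rightarrow> complex mat) \<Rightarrow> nat \<Rightarrow> complex mat" where
  "Q_mat l a m =
     mat (m * l) (m * l)
       (\<lambda>(i, j). Q_block l a m (i div l) (j div l) $$ (i mod l, j mod l))"

lemma Q_mat_1: "a 1 \<in> carrier_mat l l \<Longrightarrow> Q_mat l a 1 = a 1"
  by (intro eq_matI) (auto simp: Q_mat_def Q_block_def)

end

theory Submission
  imports Defs
begin

text \<open>
  The block column $V = (p_{m-1}, -p_{m-2}, \ldots, \pm p_0)$ satisfies
  $Q_m V = (p_m, 0, \ldots, 0)$ by the recurrence. Completing $V$ by the first $m - 1$ standard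
  block columns gives a square matrix $W$ which, up to a cyclic shift of its columns, is upper
  triangular with diagonal blocks $I, \ldots, I, \pm I$; the signs of the shift and of the last
  block cancel, so $\det W = 1$. The product $Q_m W$ has first block column $(p_m, 0, \ldots, 0)$,
  and its remaining lower right part is upper triangular with unit diagonal because of the identity
  blocks below the diagonal of $Q_m$.
\<close>

lemma sum_lessThan_add:
  fixes f :: "nat \<Rightarrow> 'a :: comm_monoid_add"
  shows "(\<Sum>k<m + n. f k) = (\<Sum>k<m. f k) + (\<Sum>k<n. f (m + k))"
  by (induction n) (simp_all add: ac_simps)

lemma index_mult_mat_sum:
  assumes "A \<in> carrier_mat n k" "B \<in> carrier_mat k c" "i < n" "j < c"
  shows "(A * B) $$ (i, j) = (\<Sum>x<k. A $$ (i, x) * B $$ (x, j))"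
  using assms by (simp add: scalar_prod_def lessThan_atLeast0)

text \<open>Only rows with \<open>i div l < m\<close> occur, so the subtraction on nat never
  truncates and the bottom block is a signed \<open>left_cheb l a 0\<close>.\<close>

definition cheb_col :: "nat \<Rightarrow> (nat \<Rightarrow> complex mat) \<Rightarrow> nat \<Rightarrow> complex mat" where
  "cheb_col l a m =
     mat (m * l) l (\<lambda>(i, j). (-1) ^ (i div l) * left_cheb l a (m - 1 - i div l) $$ (i mod l, j))"

text \<open>The standard columns stand behind V, shifted by \<open>l\<close>, so that the block p_m
  of the product lands in the top left corner.\<close>

definition cheb_frame :: "nat \<Rightarrow> (nat \<Rightarrow> complex mat) \<Rightarrow> nat \<Rightarrow> complex mat" where
  "cheb_frame l a m =
     mat (m * l) (m * l) (\<lambda>(i, j). if j < l then cheb_col l a m $$ (i, j) else of_bool (i = j - l))"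

lemma Q_mat_carrier [simp]: "Q_mat l a m \<in> carrier_mat (m * l) (m * l)"
  by (simp add: Q_mat_def)

lemma cheb_col_carrier [simp]: "cheb_col l a m \<in> carrier_mat (m * l) l"
  by (simp add: cheb_col_def)

lemma cheb_frame_carrier [simp]: "cheb_frame l a m \<in> carrier_mat (m * l) (m * l)"
  by (simp add: cheb_frame_def)

lemma left_cheb_carrier:
  assumes "\<And>k. k \<ge> 1 \<Longrightarrow> a k \<in> carrier_mat l l"
  shows "left_cheb l a m \<in> carrier_mat l l"
  using assms by (induction l a m rule: left_cheb.induct) (auto intro!: minus_carrier_mat)

lemma less_mult_imp_pos: "(i::nat) < m * l \<Longrightarrow> 0 < l"
  by (cases l) auto

text \<open>The diagonal blocks are numbered downwards, so deleting the first block row and column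
  leaves Q_m. In the border, \<open>of_bool (i = j)\<close> encodes the blocks I, O, ..., O. This
  block form drives the induction on \<open>m\<close>.\<close>

lemma Q_mat_Suc_index:
  shows "i < l \<Longrightarrow> j < l \<Longrightarrow> Q_mat l a (Suc m) $$ (i, j) = a (Suc m) $$ (i, j)"
    and "i < l \<Longrightarrow> j < m * l \<Longrightarrow> Q_mat l a (Suc m) $$ (i, l + j) = of_bool (i = j)"
    and "i < m * l \<Longrightarrow> j < l \<Longrightarrow> Q_mat l a (Suc m) $$ (l + i, j) = of_bool (i = j)"
    and "i < m * l \<Longrightarrow> j < m * l \<Longrightarrow> Q_mat l a (Suc m) $$ (l + i, l + j) = Q_mat l a m $$ (i, j)"
proof -
  show "i < l \<Longrightarrow> j < l \<Longrightarrow> Q_mat l a (Suc m) $$ (i, j) = a (Suc m) $$ (i, j)"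
    by (simp add: Q_mat_def Q_block_def trans_less_add1)
  show "i < l \<Longrightarrow> j < m * l \<Longrightarrow> Q_mat l a (Suc m) $$ (i, l + j) = of_bool (i = j)"
    using less_mult_imp_pos[of j m l]
    by (auto simp: Q_mat_def Q_block_def trans_less_add1 div_eq_0_iff)
  show "i < m * l \<Longrightarrow> j < l \<Longrightarrow> Q_mat l a (Suc m) $$ (l + i, j) = of_bool (i = j)"
    using less_mult_imp_pos[of i m l]
    by (auto simp: Q_mat_def Q_block_def trans_less_add1 div_eq_0_iff)
  show "i < m * l \<Longrightarrow> j < m * l \<Longrightarrow> Q_mat l a (Suc m) $$ (l + i, l + j) = Q_mat l a m $$ (i, j)"
    using less_mult_imp_pos[of i m l]
    by (auto simp: Q_mat_def Q_block_def)
qed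

text \<open>Moving down by one block flips the sign, so V_(m+1) is p_m on top of -V_m, in step with
  the block form of Q_(m+1).\<close>

lemma cheb_col_Suc_index:
  shows "i < l \<Longrightarrow> j < l \<Longrightarrow> cheb_col l a (Suc m) $$ (i, j) = left_cheb l a m $$ (i, j)"
    and "i < m * l \<Longrightarrow> j < l \<Longrightarrow> cheb_col l a (Suc m) $$ (l + i, j) = - cheb_col l a m $$ (i, j)"
  by (auto simp: cheb_col_def trans_less_add1)

text \<open>Induction on \<open>m\<close>: the top block row yields a_(m+1) p_m minus the first
  block of V_m, which is the recurrence; the remaining rows yield (p_m, 0, ..., 0) - Q_m V_m, which
  vanishes by the induction hypothesis.\<close>

lemma Q_mat_mult_cheb_col:
  assumes a: "\<And>k. k \<ge> 1 \<Longrightarrow> a k \<in> carrier_mat l l"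
    and "i < m * l" and "j < l"
  shows "(Q_mat l a m * cheb_col l a m) $$ (i, j) = (if i < l then left_cheb l a m $$ (i, j) else 0)"
  using assms(2)
proof (induction m arbitrary: i)
  case 0
  then show ?case by simp
next
  case (Suc m)
  note j = \<open>j < l\<close>
  have carr: "left_cheb l a k \<in> carrier_mat l l" for k
    using a by (rule left_cheb_carrier)
  have prod: "(Q_mat l a (Suc m) * cheb_col l a (Suc m)) $$ (i, j) =
      (\<Sum>k<l. Q_mat l a (Suc m) $$ (i, k) * left_cheb l a m $$ (k, j))
      - (\<Sum>k<m * l. Q_mat l a (Suc m) $$ (i, l + k) * cheb_col l a m $$ (k, j))"
    using Suc.prems j
    by (subst index_mult_mat_sum[OF Q_mat_carrier cheb_col_carrier])
       (simp_all add: sum_lessThan_add cheb_col_Suc_index sum_negf)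
  show ?case
  proof (cases "i < l")
    case True
    have "(\<Sum>k<l. Q_mat l a (Suc m) $$ (i, k) * left_cheb l a m $$ (k, j))
        = (a (Suc m) * left_cheb l a m) $$ (i, j)"
      using True j by (subst index_mult_mat_sum[OF a carr]) (simp_all add: Q_mat_Suc_index)
    moreover have "(\<Sum>k<m * l. Q_mat l a (Suc m) $$ (i, l + k) * cheb_col l a m $$ (k, j))
        = (\<Sum>k<m * l. if k = i then cheb_col l a m $$ (k, j) else 0)"
      using True by (intro sum.cong) (auto simp: Q_mat_Suc_index)
    \<comment> \<open>The \<open>else\<close> branch covers \<open>m = 0\<close>: V_0 has no rows,
      and 0 stands for p_{-1} = O.\<close>
    moreover have "left_cheb l a (Suc m) $$ (i, j) = (a (Suc m) * left_cheb l a m) $$ (i, j)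
        - (if i < m * l then cheb_col l a m $$ (i, j) else 0)"
    proof (cases m)
      case 0
      then show ?thesis using True j a[of 1] by simp
    next
      case (Suc n)
      then show ?thesis
        using True j a[of "Suc m"] carr[of n] carr[of m]
        by (simp add: cheb_col_Suc_index trans_less_add1)
    qed
    ultimately show ?thesis
      using True by (simp add: prod sum.delta)
  next
    case False
    then obtain i' where i': "i = l + i'" by (metis le_Suc_ex not_less)
    then have i'_less: "i' < m * l" using Suc.prems by simp
    \<comment> \<open>The border contributes p_m in the rows \<open>i' < l\<close> and nothing below
      them, exactly what Q_m V_m subtracts.\<close>
    have "(\<Sum>k<l. Q_mat l a (Suc m) $$ (i, k) * left_cheb l a m $$ (k, j))
        = (\<Sum>k<l. if k = i' then left_cheb l a m $$ (k, j) else 0)"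
      using i'_less by (intro sum.cong) (auto simp: i' Q_mat_Suc_index)
    moreover have "(\<Sum>k<m * l. Q_mat l a (Suc m) $$ (i, l + k) * cheb_col l a m $$ (k, j))
        = (Q_mat l a m * cheb_col l a m) $$ (i', j)"
      using i'_less j
      by (subst index_mult_mat_sum[OF Q_mat_carrier cheb_col_carrier])
         (simp_all add: i' Q_mat_Suc_index)
    ultimately show ?thesis
      using Suc.IH[OF i'_less] by (simp add: prod[unfolded i'] sum.delta i')
  qed
qed

lemma Q_mat_mult_cheb_frame_index:
  assumes a: "\<And>k. k \<ge> 1 \<Longrightarrow> a k \<in> carrier_mat l l"
    and i: "i < m * l" and j: "j < m * l"
  shows "(Q_mat l a m * cheb_frame l a m) $$ (i, j) =
    (if j < l then if i < l then left_cheb l a m $$ (i, j) else 0 else Q_mat l a m $$ (i, j - l))"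
proof (cases "j < l")
  case True
  then have "(Q_mat l a m * cheb_frame l a m) $$ (i, j) = (Q_mat l a m * cheb_col l a m) $$ (i, j)"
    unfolding index_mult_mat_sum[OF Q_mat_carrier cheb_frame_carrier i j]
      index_mult_mat_sum[OF Q_mat_carrier cheb_col_carrier i True]
    using j by (simp add: cheb_frame_def)
  then show ?thesis
    using Q_mat_mult_cheb_col[OF a i True] True by simp
next
  case False
  have "(Q_mat l a m * cheb_frame l a m) $$ (i, j)
      = (\<Sum>k<m * l. if k = j - l then Q_mat l a m $$ (i, k) else 0)"
    unfolding index_mult_mat_sum[OF Q_mat_carrier cheb_frame_carrier i j]
    using False j by (intro sum.cong) (auto simp: cheb_frame_def)
  then show ?thesis
    using False j by (simp add: sum.delta)
qed

text \<open>Moving the block V behind the \<open>n * l\<close> standard columns costs the sign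
  (-1)^(n l l), and the triangular matrix obtained has determinant (-1)^(n l).\<close>

lemma det_cheb_frame: "det (cheb_frame l a (Suc n)) = 1"
proof -
  let ?S = "mat (n * l + l) (n * l + l)
    (\<lambda>(i, j). cheb_frame l a (Suc n) $$ (i, if j < n * l then j + l else j - n * l))"
  have S_left: "?S $$ (i, j) = of_bool (i = j)" if "i < n * l + l" "j < n * l" for i j
    using that by (simp add: cheb_frame_def)
  \<comment> \<open>The last block of V is (-1)^n p_0, and p_0 = I.\<close>
  have S_right: "?S $$ (n * l + i, n * l + j) = (-1) ^ n * of_bool (i = j)"
    if "i < l" "j < l" for i j
    using that by (simp add: cheb_frame_def cheb_col_def trans_less_add1)
  have "upper_triangular ?S"
  proof
    fix i j assume ij: "j < i" "i < dim_row ?S"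
    show "?S $$ (i, j) = 0"
    proof (cases "j < n * l")
      case True
      then show ?thesis using S_left[of i j] ij by simp
    next
      case False
      then obtain i' j' where "i = n * l + i'" "j = n * l + j'"
        using ij by (metis le_Suc_ex less_imp_le not_less order.trans)
      then show ?thesis using S_right[of i' j'] ij by simp
    qed
  qed
  then have "det ?S = prod_list (diag_mat ?S)"
    by (rule det_upper_triangular[OF _ mat_carrier])
  also have "\<dots> = (\<Prod>i<n * l + l. ?S $$ (i, i))"
    by (simp add: prod_list_diag_prod lessThan_atLeast0)
  also have "\<dots> = (\<Prod>i<n * l + l. if i < n * l then 1 else (-1) ^ n)"
  proof (rule prod.cong)
    fix i assume i: "i \<in> {..<n * l + l}"
    show "?S $$ (i, i) = (if i < n * l then 1 else (-1) ^ n)"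
      using i S_left[of i i] S_right[of "i - n * l" "i - n * l"] by (cases "i < n * l") auto
  qed simp
  also have "\<dots> = ((-1) ^ n) ^ l"
  proof -
    have "{..<n * l + l} = {..<n * l} \<union> {n * l..<n * l + l}" by auto
    then show ?thesis by (simp add: prod.union_disjoint ivl_disj_int)
  qed
  finally have "det ?S = ((-1) ^ n) ^ l" .
  moreover have "det (cheb_frame l a (Suc n)) = (-1) ^ (n * l * l) * det ?S"
    by (rule det_swap_cols) (use cheb_frame_carrier[of l a "Suc n"] in \<open>simp add: add.commute\<close>)
  \<comment> \<open>The total exponent is n l (l + 1), and l (l + 1) is even.\<close>
  moreover have "even (n * l * l + n * l)" by auto
  ultimately show ?thesis
    by (simp flip: power_mult power_add)
qed

theorem proposition45:
  fixes l m :: nat and a :: "nat \<Rightarrow> complex mat"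
  assumes "l \<ge> 1"
    and "\<And>k. k \<ge> 1 \<Longrightarrow> a k \<in> carrier_mat l l"
    and "\<And>k. k \<ge> 1 \<Longrightarrow> invertible_mat (a k)"
    and "m \<ge> 1"
  shows "det (Q_mat l a m) = det (left_cheb l a m)"
proof -
  obtain n where m: "m = Suc n" using assms(4) by (cases m) auto
  define B where "B = mat l (n * l) (\<lambda>(i, j). Q_mat l a m $$ (i, j))"
  \<comment> \<open>Column \<open>l + j\<close> of the product is column \<open>j\<close> of Q, so
    the lower right part is Q without its first block row and last block column; its diagonal blocks
    are the subdiagonal blocks I of Q.\<close>
  define D where "D = mat (n * l) (n * l) (\<lambda>(i, j). Q_mat l a m $$ (l + i, j))"
  have p: "left_cheb l a m \<in> carrier_mat l l"
    using assms(2) by (rule left_cheb_carrier)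
  have blocks: "Q_mat l a m * cheb_frame l a m = four_block_mat (left_cheb l a m) B (0\<^sub>m (n * l) l) D"
  proof (rule eq_matI)
    fix i j
    assume "i < dim_row (four_block_mat (left_cheb l a m) B (0\<^sub>m (n * l) l) D)"
      and "j < dim_col (four_block_mat (left_cheb l a m) B (0\<^sub>m (n * l) l) D)"
    then have ij: "i < m * l" "j < m * l"
      using p by (auto simp: m D_def)
    show "(Q_mat l a m * cheb_frame l a m) $$ (i, j) =
        four_block_mat (left_cheb l a m) B (0\<^sub>m (n * l) l) D $$ (i, j)"
      by (subst Q_mat_mult_cheb_frame_index[OF assms(2) ij])
         (use p ij in \<open>auto simp: m B_def D_def\<close>)
  qed (use p Q_mat_carrier[of l a m] cheb_frame_carrier[of l a m] in \<open>auto simp: m B_def D_def\<close>)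
  \<comment> \<open>Row \<open>l + i\<close> of Q lies in block row \<open>i div l + 1\<close>. If
    \<open>j div l = i div l\<close>, the entry is in a subdiagonal block I; if
    \<open>j div l\<close> is smaller, it is at least two blocks below the diagonal and hence
    0.\<close>
  have D_index: "D $$ (i, j) = of_bool (i = j)" if "i < n * l" "j \<le> i" for i j
  proof -
    have "j div l \<le> i div l" using that by (simp add: div_le_mono)
    moreover have "i = j" if "i div l = j div l" "i mod l = j mod l"
      using that by (metis div_mult_mod_eq)
    ultimately show ?thesis
      using that assms(1) by (auto simp: D_def Q_mat_def Q_block_def m)
  qed
  have "upper_triangular D"
    using D_index by (auto simp: D_def)
  then have "det D = prod_list (diag_mat D)"
    by (rule det_upper_triangular[of _ "n * l"]) (simp add: D_def)
  also have "\<dots> = 1"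
  proof -
    have "dim_row D = n * l" by (simp add: D_def)
    then show ?thesis by (simp add: prod_list_diag_prod D_index)
  qed
  finally have "det D = 1" .
  have "det (Q_mat l a m) = det (Q_mat l a m * cheb_frame l a m)"
    by (simp add: det_mult[OF Q_mat_carrier cheb_frame_carrier] m det_cheb_frame)
  also have "\<dots> = det (left_cheb l a m) * det D"
    unfolding blocks by (rule det_four_block_mat_lower_left_zero) (use p in \<open>auto simp: B_def D_def\<close>)
  finally show ?thesis
    using \<open>det D = 1\<close> by simp
qed

end
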